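(* Let $X\neq\{0\}$ be a vector lattice that is a local algebra and that has no singleton maximal d-independent system (i.e. no maximal d-independent system consisting of exactly one element). If, additionally, $X$ satisfies the countable sup property, i.e. every family of pairwise disjoint non-zero elements in $X$ is at most countable, then every maximal d-independent system in $X$ is infinite.
   Context: All vector lattices are real and Archimedean. A system of non-zero elements $\{x_\gamma\}_{\gamma\in\Gamma}$ in a vector lattice $X$ is d-independent if for every band $B$ in $X$, every finite set of (distinct) indices $\{\gamma_1,\dots,\gamma_n\}\subseteq\Gamma$ and all non-zero scalars $c_1,\dots,c_n$: if $\sum_{j=1}^n c_jx_{\gamma_j}\perp B$, then $x_{\gamma_j}\perp B$ for each $j=1,\dots,n$. A maximal d-independent system is one that is maximal by inclusion among d-independent systems (of non-zero elements). For $x\in X$ let $X(x)=\{x'\in X:|x'|\le\lambda|x|\text{ for some }\lambda\in\mathbb{R}\}$ be the principal ideal generated by $x$. There is a compact Hausdorff space $K_x$, unique up to homeomorphism, such that $X(x)$ is order isomorphic (linearly and lattice isomorphic) to an order dense vector sublattice of $C(K_x)$ separating the points of $K_x$, with $|x|$ mapped to the constant function $\mathbf{1}$ (the Kakutani–Krein representation). $X$ is a local algebra if for each $x\in X$ the image of $X(x)$ under this representation is a subalgebra (as well as a vector sublattice) of $C(K_x)$. *)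

theory Defs
  imports "HOL-Analysis.Analysis" "HOL-Library.Lattice_Algebras"
begin

text \<open>
  The type itself is the vector lattice; the modulus is the one of
  \<^class>\<open>lattice_ab_group_add_abs\<close>, that is \<open>\<bar>x\<bar> = sup x (- x)\<close>.
\<close>

class archimedean_vector_lattice = ordered_real_vector + lattice_ab_group_add_abs +
  assumes archimedean: "(\<And>n::nat. of_nat n *\<^sub>R x \<le> y) \<Longrightarrow> x \<le> 0"

definition perp :: "'a::archimedean_vector_lattice \<Rightarrow> 'a \<Rightarrow> bool" (infix "\<perp>" 50)
  where "x \<perp> y \<longleftrightarrow> inf \<bar>x\<bar> \<bar>y\<bar> = 0"

definition perp_set :: "'a::archimedean_vector_lattice \<Rightarrow> 'a set \<Rightarrow> bool" (infix "\<perp>\<^sub>s" 50)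
  where "x \<perp>\<^sub>s B \<longleftrightarrow> (\<forall>b\<in>B. x \<perp> b)"

definition order_ideal :: "'a::archimedean_vector_lattice set \<Rightarrow> bool"
  where "order_ideal I \<longleftrightarrow> subspace I \<and> (\<forall>x\<in>I. \<forall>y. \<bar>y\<bar> \<le> \<bar>x\<bar> \<longrightarrow> y \<in> I)"

definition is_sup :: "'a::order set \<Rightarrow> 'a \<Rightarrow> bool"
  where "is_sup A s \<longleftrightarrow> (\<forall>a\<in>A. a \<le> s) \<and> (\<forall>u. (\<forall>a\<in>A. a \<le> u) \<longrightarrow> s \<le> u)"

definition band :: "'a::archimedean_vector_lattice set \<Rightarrow> bool"
  where "band B \<longleftrightarrow> order_ideal B \<and> (\<forall>A s. A \<subseteq> B \<and> is_sup A s \<longrightarrow> s \<in> B)"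

definition d_independent_family :: "('i \<Rightarrow> 'a::archimedean_vector_lattice) \<Rightarrow> 'i set \<Rightarrow> bool"
  where "d_independent_family x \<Gamma> \<longleftrightarrow>
    (\<forall>\<gamma>\<in>\<Gamma>. x \<gamma> \<noteq> 0) \<and>
    (\<forall>B F (c :: 'i \<Rightarrow> real).
       band B \<and> finite F \<and> F \<subseteq> \<Gamma> \<and> (\<forall>\<gamma>\<in>F. c \<gamma> \<noteq> 0) \<and> (\<Sum>\<gamma>\<in>F. c \<gamma> *\<^sub>R x \<gamma>) \<perp>\<^sub>s B
       \<longrightarrow> (\<forall>\<gamma>\<in>F. x \<gamma> \<perp>\<^sub>s B))"

text \<open>
  A d-independent family is injective (apply the condition with \<open>B = UNIV\<close> to \<open>x \<gamma> - x \<delta> = 0\<close>),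
  so such systems are the same thing as sets indexed by their own elements; it is for these
  that maximality by inclusion is meant.
\<close>

definition d_independent :: "'a::archimedean_vector_lattice set \<Rightarrow> bool"
  where "d_independent D \<longleftrightarrow> d_independent_family (\<lambda>x. x) D"

definition maximal_d_independent :: "'a::archimedean_vector_lattice set \<Rightarrow> bool"
  where "maximal_d_independent D \<longleftrightarrow>
    d_independent D \<and> (\<forall>D'. d_independent D' \<and> D \<subseteq> D' \<longrightarrow> D' = D)"

definition principal_ideal :: "'a::archimedean_vector_lattice \<Rightarrow> 'a set"
  where "principal_ideal x = {y. \<exists>c::real. \<bar>y\<bar> \<le> c *\<^sub>R \<bar>x\<bar>}"

text \<open>
  A function on the space \<open>K\<close> is represented by its extension by zero outside
  \<open>topspace K\<close>. Equality, order and all operations of \<open>C(K)\<close> are then the pointwise ones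
  of the function type, and the constant function 1 is \<open>indicator (topspace K)\<close>.
\<close>

definition cont_funs :: "'k topology \<Rightarrow> ('k \<Rightarrow> real) set"
  where "cont_funs K =
    {f. continuous_map K euclideanreal f \<and> (\<forall>t. t \<notin> topspace K \<longrightarrow> f t = 0)}"

definition vector_sublattice_of_C :: "'k topology \<Rightarrow> ('k \<Rightarrow> real) set \<Rightarrow> bool"
  where "vector_sublattice_of_C K S \<longleftrightarrow>
    S \<subseteq> cont_funs K \<and> (\<lambda>t. 0) \<in> S \<and>
    (\<forall>f\<in>S. \<forall>g\<in>S. (\<lambda>t. f t + g t) \<in> S) \<and>
    (\<forall>f\<in>S. \<forall>c. (\<lambda>t. c * f t) \<in> S) \<and>
    (\<forall>f\<in>S. \<forall>g\<in>S. sup f g \<in> S \<and> inf f g \<in> S)"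

definition subalgebra_of_C :: "'k topology \<Rightarrow> ('k \<Rightarrow> real) set \<Rightarrow> bool"
  where "subalgebra_of_C K S \<longleftrightarrow>
    S \<subseteq> cont_funs K \<and> (\<lambda>t. 0) \<in> S \<and>
    (\<forall>f\<in>S. \<forall>g\<in>S. (\<lambda>t. f t + g t) \<in> S) \<and>
    (\<forall>f\<in>S. \<forall>c. (\<lambda>t. c * f t) \<in> S) \<and>
    (\<forall>f\<in>S. \<forall>g\<in>S. (\<lambda>t. f t * g t) \<in> S)"

definition order_dense_in_C :: "'k topology \<Rightarrow> ('k \<Rightarrow> real) set \<Rightarrow> bool"
  where "order_dense_in_C K S \<longleftrightarrow>
    (\<forall>f\<in>cont_funs K. (\<lambda>t. 0) < f \<longrightarrow> (\<exists>g\<in>S. (\<lambda>t. 0) < g \<and> g \<le> f))"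

definition separates_points :: "'k topology \<Rightarrow> ('k \<Rightarrow> real) set \<Rightarrow> bool"
  where "separates_points K S \<longleftrightarrow>
    (\<forall>s\<in>topspace K. \<forall>t\<in>topspace K. s \<noteq> t \<longrightarrow> (\<exists>f\<in>S. f s \<noteq> f t))"

definition kakutani_krein_rep ::
    "'a::archimedean_vector_lattice \<Rightarrow> 'k topology \<Rightarrow> ('a \<Rightarrow> 'k \<Rightarrow> real) \<Rightarrow> bool"
  where "kakutani_krein_rep x K T \<longleftrightarrow>
    compact_space K \<and> Hausdorff_space K \<and>
    inj_on T (principal_ideal x) \<and>
    (\<forall>u\<in>principal_ideal x. \<forall>v\<in>principal_ideal x. T (u + v) = (\<lambda>t. T u t + T v t)) \<and>
    (\<forall>u\<in>principal_ideal x. \<forall>c. T (c *\<^sub>R u) = (\<lambda>t. c * T u t)) \<and>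
    (\<forall>u\<in>principal_ideal x. \<forall>v\<in>principal_ideal x.
       T (sup u v) = sup (T u) (T v) \<and> T (inf u v) = inf (T u) (T v)) \<and>
    vector_sublattice_of_C K (T ` principal_ideal x) \<and>
    order_dense_in_C K (T ` principal_ideal x) \<and>
    separates_points K (T ` principal_ideal x) \<and>
    T \<bar>x\<bar> = indicator (topspace K)"

text \<open>
  The representation exists and is unique up to a homeomorphism of \<open>K\<close>, so it does not matter
  which one is tested. Taking the points of \<open>K\<close> in \<^typ>\<open>'a \<Rightarrow> real\<close> is no
  restriction: since the image separates points, sending \<open>t\<close> to the function equal to
  \<open>T u t\<close> for \<open>u\<close> in the principal ideal and 0 elsewhere is injective.
  For \<open>x = 0\<close> the space \<open>K\<close> is empty.
\<close>

definition local_algebra :: "'a::archimedean_vector_lattice itself \<Rightarrow> bool"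
  where "local_algebra _ \<longleftrightarrow>
    (\<forall>x::'a. \<exists>(K :: ('a \<Rightarrow> real) topology) T.
       kakutani_krein_rep x K T \<and> subalgebra_of_C K (T ` principal_ideal x))"

definition countable_sup_property :: "'a::archimedean_vector_lattice itself \<Rightarrow> bool"
  where "countable_sup_property _ \<longleftrightarrow>
    (\<forall>A :: 'a set. 0 \<notin> A \<and> pairwise (\<perp>) A \<longrightarrow> countable A)"

end

theory Submission
  imports Defs "HOL-Computational_Algebra.Polynomial"
begin

text \<open>
  A finite maximal d-independent system \<open>D\<close> would force every element of the vector lattice to be
  locally a multiple of the single element \<open>u = (\<Sum>d\<in>D. \<bar>d\<bar>)\<close>, so that \<open>{u}\<close> itself would be a
  maximal d-independent system. The word "locally" is made precise by disjointness: \<open>y\<close> and \<open>z\<close> agree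
  on the support of \<open>b\<close> if \<open>b \<perp> y - z\<close>.

  Maximality of a finite \<open>D\<close> says that every non-zero \<open>z\<close> is a linear combination of \<open>D\<close>
  on some part of its own support (\<open>maximal_d_independent_locally_spans\<close>). It does not say that
  a given \<open>z\<close> is such a combination near every point, and closing this gap is where
  the countable sup property enters. Given \<open>x\<close>, take \<open>w = \<bar>x\<bar> + u\<close>. The principal ideal of \<open>w\<close> contains
  \<open>D\<close>, \<open>u\<close> and \<open>x\<close> and is represented by an algebra \<open>S\<close> of functions. Let \<open>f\<close> and \<open>b \<noteq> 0\<close> be in \<open>S\<close>, let
  \<open>m\<close> be the cardinality of \<open>D\<close>, and consider, for each real \<open>s\<close>, the function
  \<open>z\<^sub>s = (1 + s f + \<dots> + s\<^sup>m f\<^sup>m) b\<close> in \<open>S\<close>, where \<open>s\<^sup>m\<close> and \<open>f\<^sup>m\<close> are \<open>m\<close>-th powers. If one of them vanishes,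
  \<open>f\<close> satisfies a polynomial equation on the support of \<open>b\<close>. Otherwise each \<open>z\<^sub>s\<close> is a combination of
  \<open>D\<close> on the support of some non-zero \<open>g\<^sub>s\<close>. There are uncountably many \<open>s\<close> and disjoint families are
  countable, so \<open>m + 1\<close> of these supports have a common point (\<open>common_support\<close>). On their
  intersection \<open>m + 1\<close> functions \<open>z\<^sub>s\<close> lie in the span of \<open>m\<close> functions, hence satisfy a linear relation;
  as the polynomials involved are linearly independent by a Vandermonde argument
  (\<open>moment_poly_independent\<close>), \<open>f\<close> again satisfies a non-trivial polynomial equation there.
  A function with such an equation takes finitely many values, and multiplying by factors \<open>f - r\<close>
  inside the algebra cuts out a piece on which it is constant (\<open>locally_constant\<close>).

  Applied to \<open>x\<close> and \<open>u\<close>, this yields a common piece on which both are constant; there \<open>u\<close> is not zero,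
  because \<open>D\<close> spans something non-zero on a part of it, and so \<open>x\<close> is a multiple of \<open>u\<close>
  (\<open>locally_multiple_of_sum\<close>). Throughout, supports of functions in \<open>S\<close> take the place of open sets
  of the representing space.
\<close>

section \<open>Disjointness in vector lattices\<close>

lemma perp_commute: "x \<perp> y \<longleftrightarrow> y \<perp> x"
  by (simp add: perp_def inf_commute)

lemma perp_mono:
  assumes "a \<perp> y" "\<bar>z\<bar> \<le> \<bar>y\<bar>"
  shows "a \<perp> z"
proof -
  have "inf (abs a) (abs z) \<le> inf (abs a) (abs y)"
    using assms(2) by (rule inf_mono[OF order_refl])
  also have "\<dots> = 0" using assms(1) by (simp add: perp_def)
  finally show ?thesis unfolding perp_def by (intro antisym) simp_all
qed

lemma perp_self_iff: "x \<perp> x \<longleftrightarrow> x = 0"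
  by (simp add: perp_def)

lemma perp_0: "a \<perp> 0"
  by (simp add: perp_def inf_absorb2)

lemma inf_add_le:
  fixes a p q :: "'a::lattice_ab_group_add_abs"
  assumes "0 \<le> a" "0 \<le> p" "0 \<le> q"
  shows "inf a (p + q) \<le> inf a p + inf a q"
proof -
  have "inf a (p + q) \<le> a + a" "inf a (p + q) \<le> p + a" "inf a (p + q) \<le> a + q"
    using assms by (auto intro: le_infI1 add_increasing add_increasing2)
  then show ?thesis
    by (simp add: add_inf_distrib_left add_inf_distrib_right)
qed

lemma abs_scaleR_le:
  fixes y :: "'a::archimedean_vector_lattice"
  shows "\<bar>c *\<^sub>R y\<bar> \<le> \<bar>c\<bar> *\<^sub>R \<bar>y\<bar>"
proof -
  have *: "c *\<^sub>R y \<le> \<bar>c\<bar> *\<^sub>R \<bar>y\<bar>" for c :: real and y :: 'a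
  proof (cases "c \<ge> 0")
    case True
    then show ?thesis using scaleR_left_mono[OF abs_ge_self, of c y] by simp
  next
    case False
    then have "(- c) *\<^sub>R (- y) \<le> (- c) *\<^sub>R \<bar>y\<bar>"
      by (intro scaleR_left_mono abs_ge_minus_self) auto
    with False show ?thesis by simp
  qed
  show ?thesis
    using *[of c y] *[of c "- y"] by (intro abs_leI) auto
qed

lemma perp_add:
  assumes "a \<perp> y" "a \<perp> z"
  shows "a \<perp> y + z"
proof -
  have "inf (abs a) (abs y + abs z) \<le> inf (abs a) (abs y) + inf (abs a) (abs z)"
    by (rule inf_add_le) auto
  then have "inf (abs a) (abs y + abs z) = 0"
    using assms by (intro antisym) (auto simp: perp_def)
  then have "a \<perp> \<bar>y\<bar> + \<bar>z\<bar>"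
    by (simp add: perp_def)
  then show ?thesis
    by (rule perp_mono) (auto intro: abs_triangle_ineq order_trans[OF _ abs_ge_self])
qed

text \<open>The scalar is bounded by a natural number, and natural multiples are iterated sums.\<close>

lemma perp_scaleR:
  assumes "a \<perp> y"
  shows "a \<perp> c *\<^sub>R y"
proof -
  have abs: "a \<perp> \<bar>y\<bar>" using assms by (simp add: perp_def)
  have multiple: "a \<perp> of_nat n *\<^sub>R \<bar>y\<bar>" for n
  proof (induction n)
    case 0
    then show ?case by (simp add: perp_0)
  next
    case (Suc n)
    from perp_add[OF abs Suc] show ?case by (simp add: scaleR_add_left)
  qed
  obtain n :: nat where n: "\<bar>c\<bar> \<le> of_nat n"
    using real_arch_simple by blast
  have "\<bar>c *\<^sub>R y\<bar> \<le> \<bar>c\<bar> *\<^sub>R \<bar>y\<bar>" by (rule abs_scaleR_le)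
  also have "\<dots> \<le> of_nat n *\<^sub>R \<bar>y\<bar>" using n by (intro scaleR_right_mono) auto
  also have "\<dots> \<le> \<bar>of_nat n *\<^sub>R \<bar>y\<bar>\<bar>" by (rule abs_ge_self)
  finally show ?thesis using multiple perp_mono by blast
qed

lemma subspace_perp: "subspace {y. a \<perp> y}"
  by (rule subspaceI) (simp_all add: perp_0 perp_add perp_scaleR)

text \<open>
  The negative part of a supremum \<open>s\<close> is dominated by that of any member of \<open>A\<close>, so only the positive
  part matters. If \<open>p = inf \<bar>a\<bar> (pprt s)\<close> were not zero, \<open>s - p\<close> would be a smaller upper bound: each
  \<open>y \<in> A\<close> is disjoint from \<open>p\<close>, so subtracting \<open>p\<close> from \<open>s\<close> does not cut into the part of \<open>s\<close> above \<open>y\<close>.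
\<close>

lemma perp_is_sup:
  assumes perp: "\<And>y. y \<in> A \<Longrightarrow> a \<perp> y" and sup: "is_sup A s"
  shows "a \<perp> s"
proof (cases "A = {}")
  case True
  \<comment> \<open>A least element of the whole space is below its own double, hence is zero.\<close>
  then have "s \<le> u" for u using sup by (simp add: is_sup_def)
  from this[of 0] this[of "s + s"] have "s = 0" by simp
  then show ?thesis by (simp add: perp_0)
next
  case False
  then obtain y0 where y0: "y0 \<in> A" by blast
  define p where "p = inf \<bar>a\<bar> (pprt s)"
  have p: "0 \<le> p" "p \<le> pprt s" "p \<le> \<bar>a\<bar>" by (auto simp: p_def)
  have neg: "a \<perp> nprt s"
  proof (rule perp_mono[OF perp[OF y0]])
    have "nprt y0 \<le> nprt s" using sup y0 by (simp add: is_sup_def nprt_mono)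
    then have "abs (nprt s) \<le> abs (nprt y0)" by (simp add: abs_of_nonpos)
    also have "\<dots> \<le> \<bar>y0\<bar>" by (simp add: abs_prts abs_of_nonpos)
    finally show "\<bar>nprt s\<bar> \<le> \<bar>y0\<bar>" .
  qed
  \<comment> \<open>The excess \<open>y + p - s\<close> lies below both \<open>p\<close> and the modulus of the negative part of \<open>s\<close>,
    which are disjoint.\<close>
  have "y \<le> s - p" if y: "y \<in> A" for y
  proof -
    have ys: "y \<le> s" using sup y by (simp add: is_sup_def)
    have "inf p (pprt y) \<le> inf (abs a) (abs y)"
      using p by (intro inf_mono) (auto simp: abs_prts)
    also have "\<dots> = 0" using perp[OF y] by (simp add: perp_def)
    finally have "inf p (pprt y) = 0"
      using p by (intro antisym) auto
    then have "p + pprt y = sup p (pprt y)"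
      using add_eq_inf_sup[of p "pprt y"] by simp
    also have "\<dots> \<le> pprt s" using p ys by (simp add: pprt_mono)
    finally have "p + pprt y \<le> pprt s" .
    moreover have "p + y \<le> p + pprt y" by (simp add: pprt_def)
    ultimately have "p + y \<le> pprt s" by (rule order_trans[rotated])
    then have "y + p - s \<le> pprt s - s" by (simp add: add.commute)
    also have "pprt s - s = - nprt s"
      by (metis prts add_diff_cancel_left' minus_diff_eq)
    finally have "y + p - s \<le> - nprt s" .
    moreover have "y + p - s \<le> p" using ys by (simp add: algebra_simps)
    ultimately have "y + p - s \<le> inf p (- nprt s)" by simp
    also have "\<dots> \<le> inf (abs a) (abs (nprt s))"
      using p by (intro inf_mono) (auto simp: abs_of_nonpos)
    also have "\<dots> = 0" using neg by (simp add: perp_def)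
    finally show ?thesis by (simp add: algebra_simps)
  qed
  then have "s \<le> s - p" using sup by (simp add: is_sup_def)
  then have "p = 0" using p by (simp add: antisym)
  then have "a \<perp> pprt s" by (simp add: perp_def p_def)
  from perp_add[OF this neg] show ?thesis by (simp flip: prts)
qed

lemma band_perp: "band {y. a \<perp> y}"
  unfolding band_def order_ideal_def
  proof (intro conjI allI ballI impI)
  show "subspace {y. a \<perp> y}" by (rule subspace_perp)
next
  fix x y assume "x \<in> {y. a \<perp> y}" "\<bar>y\<bar> \<le> \<bar>x\<bar>"
  then show "y \<in> {y. a \<perp> y}" using perp_mono[of a x y] by simp
next
  fix A s assume "A \<subseteq> {y. a \<perp> y} \<and> is_sup A s"
  then show "s \<in> {y. a \<perp> y}" using perp_is_sup[of A a s] by blast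
qed

section \<open>Maximal d-independent systems\<close>

text \<open>
  Bands can be replaced by single elements, which have images in a function representation:
  all elements disjoint from a given sum form a band.
\<close>

lemma d_independent_iff:
  "d_independent D \<longleftrightarrow> 0 \<notin> D \<and>
    (\<forall>b F c. finite F \<and> F \<subseteq> D \<and> (\<forall>d\<in>F. c d \<noteq> 0) \<and> b \<perp> (\<Sum>d\<in>F. c d *\<^sub>R d)
       \<longrightarrow> (\<forall>d\<in>F. b \<perp> d))"
  (is "_ \<longleftrightarrow> _ \<and> ?R")
proof -
  have ?R if D: "d_independent D"
  proof (intro allI impI ballI, elim conjE)
    fix b F d and c :: "'a \<Rightarrow> real"
    let ?y = "\<Sum>d\<in>F. c d *\<^sub>R d"
    assume F: "finite F" "F \<subseteq> D" "\<forall>d\<in>F. c d \<noteq> 0" "b \<perp> ?y" "d \<in> F"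
    have "band {z. ?y \<perp> z}" "?y \<perp>\<^sub>s {z. ?y \<perp> z}"
      by (auto simp: band_perp perp_set_def)
    then have "d \<perp>\<^sub>s {z. ?y \<perp> z}"
      using D F unfolding d_independent_def d_independent_family_def by blast
    then show "b \<perp> d" using F(4) by (auto simp: perp_set_def perp_commute)
  qed
  moreover have "d_independent D" if "0 \<notin> D" ?R
    unfolding d_independent_def d_independent_family_def perp_set_def
  proof (intro conjI allI impI ballI, goal_cases)
    case 1
    then show ?case using that(1) by blast
  next
    case (2 B F c d b)
    then have "b \<perp> (\<Sum>d\<in>F. c d *\<^sub>R d)" by (subst perp_commute) blast
    then have "b \<perp> d" using that(2) 2 by blast
    then show ?case by (subst perp_commute)
  qed
  moreover have "0 \<notin> D" if "d_independent D"
    using that unfolding d_independent_def d_independent_family_def by (elim conjE) blast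
  ultimately show ?thesis by blast
qed

lemma d_independentD:
  assumes "d_independent D" "finite F" "F \<subseteq> D" "\<forall>d\<in>F. c d \<noteq> 0"
    "b \<perp> (\<Sum>d\<in>F. c d *\<^sub>R d)" "d \<in> F"
  shows "b \<perp> d"
  using assms unfolding d_independent_iff by blast

lemma d_independent_singleton: "x \<noteq> 0 \<Longrightarrow> d_independent {x}"
proof -
  assume x: "x \<noteq> 0"
  have "b \<perp> x" if "F \<subseteq> {x}" "d \<in> F" "c d \<noteq> 0" "b \<perp> (\<Sum>d\<in>F. c d *\<^sub>R d)" for b F d and c :: "'a \<Rightarrow> real"
  proof -
    have "F = {x}" "d = x" using that by auto
    then show ?thesis using perp_scaleR[of b "c x *\<^sub>R x" "1 / c x"] that by simp
  qed
  then show ?thesis unfolding d_independent_iff using x by blast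
qed

text \<open>
  If \<open>z\<close> is not in \<open>D\<close>, adjoining it destroys d-independence. In a sum that witnesses this, \<open>z\<close> must
  occur, and it cannot vanish on the support of \<open>b\<close>, since in either case the sum would violate the
  d-independence of \<open>D\<close>. Solving for \<open>z\<close> gives the combination.
\<close>

lemma maximal_d_independent_locally_spans:
  assumes D: "maximal_d_independent D" "finite D" and z: "z \<noteq> 0"
  shows "\<exists>b c. \<not> b \<perp> z \<and> b \<perp> z - (\<Sum>d\<in>D. c d *\<^sub>R d)"
proof (cases "z \<in> D")
  case True
  have "(\<Sum>d\<in>D. (if d = z then 1 else 0) *\<^sub>R d) = z"
  proof -
    have "(\<Sum>d\<in>D. (if d = z then 1 else 0) *\<^sub>R d) = (\<Sum>d\<in>D. if d = z then d else 0)"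
      by (rule sum.cong) simp_all
    then show ?thesis using True D(2) by simp
  qed
  then show ?thesis using z
    by (intro exI[of _ z] exI[of _ "\<lambda>d. if d = z then 1 else 0"]) (simp add: perp_self_iff perp_0)
next
  case False
  have indep: "d_independent D" using D by (simp add: maximal_d_independent_def)
  have "\<not> d_independent (insert z D)"
    using D False unfolding maximal_d_independent_def by blast
  then obtain b F c e where F: "finite F" "F \<subseteq> insert z D" "\<forall>d\<in>F. c d \<noteq> 0"
      "b \<perp> (\<Sum>d\<in>F. c d *\<^sub>R d)" "e \<in> F" "\<not> b \<perp> e"
    using z indep unfolding d_independent_iff[of "insert z D"] d_independent_iff[of D] by auto
  have zF: "z \<in> F"
    using F indep unfolding d_independent_iff by blast
  let ?y = "\<Sum>d\<in>F - {z}. c d *\<^sub>R d"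
  have split: "(\<Sum>d\<in>F. c d *\<^sub>R d) = c z *\<^sub>R z + ?y"
    using F(1) zF by (rule sum.remove)
  have not_perp: "\<not> b \<perp> z"
  proof
    assume bz: "b \<perp> z"
    have "b \<perp> ?y"
      using subspace_diff[OF subspace_perp, of _ b "c z *\<^sub>R z"] F(4) perp_scaleR[OF bz] split
      by (metis add_diff_cancel_left' mem_Collect_eq)
    moreover have "finite (F - {z})" "F - {z} \<subseteq> D" using F by auto
    ultimately have "\<forall>d\<in>F - {z}. b \<perp> d"
      using F(3) indep unfolding d_independent_iff by blast
    with bz F show False by blast
  qed
  have rest: "b \<perp> z - (\<Sum>d\<in>D. (if d \<in> F then - c d / c z else 0) *\<^sub>R d)"
  proof -
    have "(\<Sum>d\<in>D. (if d \<in> F then - c d / c z else 0) *\<^sub>R d)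
        = (\<Sum>d\<in>F - {z}. (if d \<in> F then - c d / c z else 0) *\<^sub>R d)"
      using D(2) F(2) False by (intro sum.mono_neutral_right) auto
    also have "\<dots> = (\<Sum>d\<in>F - {z}. (- 1 / c z) *\<^sub>R (c d *\<^sub>R d))"
      by (intro sum.cong) auto
    also have "\<dots> = (- 1 / c z) *\<^sub>R ?y"
      by (simp only: scaleR_sum_right)
    finally have "z - (\<Sum>d\<in>D. (if d \<in> F then - c d / c z else 0) *\<^sub>R d)
        = (1 / c z) *\<^sub>R (\<Sum>d\<in>F. c d *\<^sub>R d)"
      using F(3) zF unfolding split by (simp add: scaleR_add_right)
    then show ?thesis using perp_scaleR[OF F(4)] by metis
  qed
  show ?thesis by (intro exI conjI) (rule not_perp, rule rest)
qed

section \<open>Algebras of functions that are locally finite dimensional\<close>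

text \<open>More vectors than coordinates are linearly dependent; this is one step of Gaussian elimination
  per coordinate.\<close>

lemma exists_linear_relation:
  fixes c :: "'i \<Rightarrow> 'd \<Rightarrow> real"
  assumes "finite D" "finite I" "card D < card I"
  shows "\<exists>l. (\<exists>i\<in>I. l i \<noteq> 0) \<and> (\<forall>d\<in>D. (\<Sum>i\<in>I. l i * c i d) = 0)"
  using assms
proof (induction D arbitrary: I c rule: finite_induct)
  case empty
  then obtain i where "i \<in> I" by fastforce
  then show ?case by (auto intro!: exI[of _ "\<lambda>_. 1"])
next
  case (insert e D)
  show ?case
  proof (cases "\<forall>i\<in>I. c i e = 0")
    case True
    then show ?thesis using insert.IH[of I c] insert by auto
  next
    case False
    then obtain k where k: "k \<in> I" "c k e \<noteq> 0" by blast
    \<comment> \<open>Row \<open>k\<close> is the pivot: it clears coordinate \<open>e\<close> in all other rows.\<close>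
    let ?c = "\<lambda>i d. c i d - c i e / c k e * c k d"
    have "card D < card (I - {k})" using insert k by simp
    then obtain l where l: "\<exists>i\<in>I - {k}. l i \<noteq> 0" "\<forall>d\<in>D. (\<Sum>i\<in>I - {k}. l i * ?c i d) = 0"
      using insert.IH[of "I - {k}" ?c] insert.prems by auto
    define l' where "l' = (\<lambda>i. if i = k then - (\<Sum>i\<in>I - {k}. l i * (c i e / c k e)) else l i)"
    have "(\<Sum>i\<in>I. l' i * c i d) = (\<Sum>i\<in>I - {k}. l i * ?c i d)" for d
    proof -
      have "(\<Sum>i\<in>I. l' i * c i d) = l' k * c k d + (\<Sum>i\<in>I - {k}. l' i * c i d)"
        using insert.prems(1) k(1) by (rule sum.remove)
      also have "(\<Sum>i\<in>I - {k}. l' i * c i d) = (\<Sum>i\<in>I - {k}. l i * c i d)"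
        by (intro sum.cong) (auto simp: l'_def)
      also have "l' k * c k d = - (\<Sum>i\<in>I - {k}. l i * (c i e / c k e * c k d))"
        by (simp add: l'_def sum_distrib_right mult.assoc)
      finally show ?thesis
        by (simp add: right_diff_distrib sum_subtractf)
    qed
    moreover have "(\<Sum>i\<in>I - {k}. l i * ?c i e) = 0" using k by simp
    ultimately have "\<forall>d\<in>insert e D. (\<Sum>i\<in>I. l' i * c i d) = 0" using l(2) by auto
    moreover have "\<exists>i\<in>I. l' i \<noteq> 0" using l(1) by (auto simp: l'_def)
    ultimately show ?thesis by blast
  qed
qed

text \<open>
  The polynomial with coefficient vector \<open>(1, s, s\<^sup>2, \<dots>)\<close>, cut off at degree \<open>m\<close>. As \<open>s\<close> varies, these
  vectors run through the moment curve. They form an uncountable family of which any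
  \<open>m + 1\<close> members are linearly independent.
\<close>

definition moment_poly :: "nat \<Rightarrow> real \<Rightarrow> real poly"
  where "moment_poly m s = (\<Sum>j\<le>m. monom (s ^ j) j)"

lemma coeff_moment_poly: "coeff (moment_poly m s) j = (if j \<le> m then s ^ j else 0)"
  by (simp add: moment_poly_def coeff_sum)

lemma moment_poly_neq_0: "moment_poly m s \<noteq> 0"
  using coeff_moment_poly[of m s 0] by auto

text \<open>
  A relation with coefficients \<open>l\<close> says that the functional \<open>r \<mapsto> (\<Sum>s\<in>I. l s * poly r s)\<close> kills all
  polynomials of degree at most \<open>m\<close>. The polynomial vanishing at all nodes except \<open>i\<close> then
  shows that \<open>l i = 0\<close>.
\<close>

lemma moment_poly_independent:
  assumes I: "finite I" "card I \<le> Suc m" and i: "i \<in> I" "l i \<noteq> 0"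
  shows "(\<Sum>s\<in>I. smult (l s) (moment_poly m s)) \<noteq> 0"
proof
  assume zero: "(\<Sum>s\<in>I. smult (l s) (moment_poly m s)) = 0"
  define r where "r = (\<Prod>s\<in>I - {i}. [:- s, 1:])"
  have "degree r = card (I - {i})"
    unfolding r_def by (subst degree_prod_eq_sum_degree) auto
  then have deg: "degree r \<le> m" using I i by simp
  have moments: "(\<Sum>s\<in>I. l s * s ^ j) = 0" if "j \<le> m" for j
    using arg_cong[OF zero, of "\<lambda>q. coeff q j"] that
    by (simp add: coeff_sum coeff_moment_poly)
  have "(\<Sum>s\<in>I. l s * poly r s) = (\<Sum>s\<in>I. \<Sum>j\<le>degree r. coeff r j * (l s * s ^ j))"
    by (simp add: poly_altdef sum_distrib_left algebra_simps)
  also have "\<dots> = (\<Sum>j\<le>degree r. coeff r j * (\<Sum>s\<in>I. l s * s ^ j))"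
    by (subst sum.swap) (simp add: sum_distrib_left)
  also have "\<dots> = 0" using moments deg by simp
  finally have "(\<Sum>s\<in>I. l s * poly r s) = 0" .
  moreover have "(\<Sum>s\<in>I. l s * poly r s) = l i * poly r i"
  proof -
    have "poly r s = 0" if "s \<in> I - {i}" for s
      using that I(1) by (auto simp: r_def poly_prod)
    then show ?thesis using I(1) i(1) by (simp add: sum.remove[of I i])
  qed
  moreover have "poly r i \<noteq> 0" using I(1) by (auto simp: r_def poly_prod)
  ultimately show False using i(2) by simp
qed

text \<open>
  The functions that represent a principal ideal vanish outside the representing space, so the constants
  of the function type need not be among them. Polynomials in \<open>f\<close> therefore appear only with a factor
  \<open>b\<close> from the algebra, which at the same time localizes them to the support of \<open>b\<close>.
\<close>

locale function_algebra =
  fixes S :: "('k \<Rightarrow> real) set"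
  assumes add: "f \<in> S \<Longrightarrow> g \<in> S \<Longrightarrow> (\<lambda>t. f t + g t) \<in> S"
    and scale: "f \<in> S \<Longrightarrow> (\<lambda>t. c * f t) \<in> S"
    and mult: "f \<in> S \<Longrightarrow> g \<in> S \<Longrightarrow> (\<lambda>t. f t * g t) \<in> S"
begin

lemma poly_mult:
  assumes "f \<in> S" "b \<in> S"
  shows "(\<lambda>t. poly p (f t) * b t) \<in> S"
proof (induction p)
  case 0
  then show ?case using scale[OF assms(2), of 0] by simp
next
  case (pCons a p)
  from add[OF scale[OF assms(2), of a] mult[OF assms(1) pCons(2)]]
  show ?case by (simp add: algebra_simps)
qed

lemma prod_closed:
  assumes "finite F" "F \<noteq> {}" "\<And>i. i \<in> F \<Longrightarrow> g i \<in> S"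
  shows "(\<lambda>t. \<Prod>i\<in>F. g i t) \<in> S"
  using assms by (induction F rule: finite_ne_induct) (auto intro: mult)

text \<open>
  On the support of \<open>b\<close> the function \<open>f\<close> takes values in the finite set of roots of \<open>q\<close>. The product
  of \<open>b\<close> with \<open>f - r\<close>, for all roots \<open>r\<close> other than \<open>f t0\<close>, is supported where \<open>f\<close> has the value \<open>f t0\<close>.
\<close>

lemma locally_constant_of_root:
  assumes fb: "f \<in> S" "b \<in> S" and q: "q \<noteq> 0" and b0: "b t0 \<noteq> 0"
    and root: "\<And>t. b t \<noteq> 0 \<Longrightarrow> poly q (f t) = 0"
  shows "\<exists>a\<in>S. \<exists>c. (\<exists>t. a t \<noteq> 0) \<and> (\<forall>t. a t \<noteq> 0 \<longrightarrow> b t \<noteq> 0 \<and> f t = c)"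
proof -
  define R where "R = {r. poly q r = 0} - {f t0}"
  define p where "p = (\<Prod>r\<in>R. [:- r, 1:])"
  have fin: "finite R" using q by (simp add: R_def poly_roots_finite)
  then have p: "poly p s = 0 \<longleftrightarrow> s \<in> R" for s
    by (auto simp: p_def poly_prod)
  have "poly p (f t0) * b t0 \<noteq> 0" using b0 p by (simp add: R_def)
  moreover have "b t \<noteq> 0 \<and> f t = f t0" if "poly p (f t) * b t \<noteq> 0" for t
    using that root[of t] p[of "f t"] by (auto simp: R_def)
  ultimately show ?thesis
    using poly_mult[OF fb, of p] by (intro bexI[of _ "\<lambda>t. poly p (f t) * b t"]) auto
qed

text \<open>
  Suppose that no \<open>n + 1\<close> of the supports meet. Then every index set whose supports meet is contained in a
  maximal one, and the products over two different maximal sets are disjoint: at a common point the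
  union of both sets would be admissible. So there are countably many maximal sets. They are finite and
  cover \<open>I\<close>, which contradicts its being uncountable.
\<close>

lemma common_support:
  assumes ccc: "\<And>A. A \<subseteq> S \<Longrightarrow> (\<And>f. f \<in> A \<Longrightarrow> \<exists>t. f t \<noteq> 0) \<Longrightarrow>
      pairwise (\<lambda>f g. \<forall>t. f t * g t = 0) A \<Longrightarrow> countable A"
    and I: "uncountable I" and g: "\<And>i. i \<in> I \<Longrightarrow> g i \<in> S" "\<And>i. i \<in> I \<Longrightarrow> \<exists>t. g i t \<noteq> 0"
  shows "\<exists>F t. F \<subseteq> I \<and> finite F \<and> card F = Suc n \<and> (\<forall>i\<in>F. g i t \<noteq> 0)"
proof (rule ccontr)
  assume none: "\<not> ?thesis"
  define Q where "Q F \<longleftrightarrow> finite F \<and> F \<noteq> {} \<and> F \<subseteq> I \<and> (\<exists>t. \<forall>i\<in>F. g i t \<noteq> 0)" for F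
  define M where "M = {F. Q F \<and> (\<forall>F'. Q F' \<and> F \<subseteq> F' \<longrightarrow> F' = F)}"
  define G where "G F = (\<lambda>t. \<Prod>i\<in>F. g i t)" for F
  have bound: "card F \<le> n" if "Q F" for F
  proof (rule ccontr)
    assume "\<not> card F \<le> n"
    then obtain F' where "F' \<subseteq> F" "card F' = Suc n" "finite F'"
      using obtain_subset_with_card_n[of "Suc n" F] by auto
    then show False using none that unfolding Q_def by blast
  qed
  have cover: "\<exists>F\<in>M. i \<in> F" if i: "i \<in> I" for i
  proof -
    have "Q {i} \<and> i \<in> {i}" using i g(2) by (auto simp: Q_def)
    then obtain F where F: "Q F" "i \<in> F" "\<And>F'. Q F' \<Longrightarrow> i \<in> F' \<Longrightarrow> card F' \<le> card F"
      using ex_has_greatest_nat[of "\<lambda>F. Q F \<and> i \<in> F" "{i}" card "Suc n"] bound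
      by (auto simp: less_Suc_eq_le)
    have "F' = F" if "Q F'" "F \<subseteq> F'" for F'
      using that F card_seteq[of F' F] by (auto simp: Q_def)
    then show ?thesis using F by (auto simp: M_def)
  qed
  have same: "F = F'" if "F \<in> M" "F' \<in> M" "G F t * G F' t \<noteq> 0" for F F' t
  proof -
    have "Q (F \<union> F')" using that by (auto simp: M_def Q_def G_def intro!: exI[of _ t])
    then show ?thesis using that by (auto simp: M_def)
  qed
  have nonzero: "\<exists>t. G F t \<noteq> 0" if "F \<in> M" for F
    using that by (auto simp: M_def Q_def G_def)
  have "inj_on G M"
    using same nonzero by (intro inj_onI) (metis mult_eq_0_iff)
  moreover have "countable (G ` M)"
  proof (rule ccc)
    show "G ` M \<subseteq> S" using g(1) by (auto simp: M_def Q_def G_def intro!: prod_closed)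
    show "pairwise (\<lambda>f g. \<forall>t. f t * g t = 0) (G ` M)"
      using same by (auto simp: pairwise_def)
  qed (use nonzero in auto)
  ultimately have "countable M" using countable_image_inj_on by blast
  moreover have "countable F" if "F \<in> M" for F
    using that by (simp add: M_def Q_def countable_finite)
  ultimately have "countable (\<Union>F\<in>M. F)" by (rule countable_UN)
  moreover have "I \<subseteq> (\<Union>F\<in>M. F)" using cover by blast
  ultimately show False using I countable_subset by blast
qed

text \<open>
  The assumption on \<open>D\<close> provides combinations only on an uncontrolled part of the support of \<open>z\<close>.
  The uncountable family \<open>z s\<close> compensates for this: some \<open>card D + 1\<close> of these parts overlap, and on the
  overlap a linear relation among the coefficient vectors turns into a polynomial equation for \<open>f\<close>.
\<close>

lemma locally_constant:
  assumes ccc: "\<And>A. A \<subseteq> S \<Longrightarrow> (\<And>f. f \<in> A \<Longrightarrow> \<exists>t. f t \<noteq> 0) \<Longrightarrow>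
      pairwise (\<lambda>f g. \<forall>t. f t * g t = 0) A \<Longrightarrow> countable A"
    and D: "finite D"
    and span: "\<And>z. z \<in> S \<Longrightarrow> \<exists>t. z t \<noteq> 0 \<Longrightarrow>
      \<exists>g\<in>S. \<exists>c. (\<exists>t. g t \<noteq> 0) \<and> (\<forall>t. g t \<noteq> 0 \<longrightarrow> z t \<noteq> 0 \<and> z t = (\<Sum>d\<in>D. c d * h d t))"
    and fb: "f \<in> S" "b \<in> S" "b t0 \<noteq> 0"
  shows "\<exists>a\<in>S. \<exists>c. (\<exists>t. a t \<noteq> 0) \<and> (\<forall>t. a t \<noteq> 0 \<longrightarrow> b t \<noteq> 0 \<and> f t = c)"
proof -
  define m where "m = card D"
  define z where "z s = (\<lambda>t. poly (moment_poly m s) (f t) * b t)" for s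
  have zS: "z s \<in> S" for s unfolding z_def using fb(1,2) by (rule poly_mult)
  show ?thesis
  proof (cases "\<exists>s. \<forall>t. z s t = 0")
    case True
    then obtain s where "\<And>t. b t \<noteq> 0 \<Longrightarrow> poly (moment_poly m s) (f t) = 0"
      by (auto simp: z_def)
    from locally_constant_of_root[OF fb(1,2) moment_poly_neq_0 fb(3) this] show ?thesis .
  next
    case False
    define P where "P s g c \<longleftrightarrow> g \<in> S \<and> (\<exists>t. g t \<noteq> 0) \<and>
        (\<forall>t. g t \<noteq> 0 \<longrightarrow> z s t \<noteq> 0 \<and> z s t = (\<Sum>d\<in>D. c d * h d t))" for s g c
    have "\<exists>g c. P s g c" for s
      unfolding P_def using span[OF zS] False by blast
    then obtain g c where "\<And>s. P s (g s) (c s)"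
      by metis
    then have g: "\<And>s. g s \<in> S" "\<And>s. \<exists>t. g s t \<noteq> 0"
        "\<And>s t. g s t \<noteq> 0 \<Longrightarrow> z s t \<noteq> 0 \<and> z s t = (\<Sum>d\<in>D. c s d * h d t)"
      unfolding P_def by blast+
    obtain I t1 where I: "finite I" "card I = Suc m" "\<forall>s\<in>I. g s t1 \<noteq> 0"
      using common_support[OF ccc uncountable_UNIV_real, of g m] g by blast
    then obtain l i where l: "i \<in> I" "l i \<noteq> 0" "\<forall>d\<in>D. (\<Sum>s\<in>I. l s * c s d) = 0"
      using exists_linear_relation[OF D I(1), of c] by (auto simp: m_def)
    define q where "q = (\<Sum>s\<in>I. smult (l s) (moment_poly m s))"
    have q: "q \<noteq> 0" unfolding q_def using I l by (intro moment_poly_independent) auto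
    define \<beta> where "\<beta> = (\<lambda>t. \<Prod>s\<in>I. g s t)"
    have \<beta>: "\<beta> \<in> S" "\<beta> t1 \<noteq> 0"
      unfolding \<beta>_def using I l(1) g(1) by (auto intro!: prod_closed)
    have supp: "b t \<noteq> 0 \<and> poly q (f t) = 0" if "\<beta> t \<noteq> 0" for t
    proof -
      have gt: "g s t \<noteq> 0" if "s \<in> I" for s
        using \<open>\<beta> t \<noteq> 0\<close> that I(1) by (auto simp: \<beta>_def)
      have "z i t \<noteq> 0" using g(3) gt l(1) by blast
      then have b: "b t \<noteq> 0" by (auto simp: z_def)
      have "poly q (f t) * b t = (\<Sum>s\<in>I. l s * z s t)"
        by (simp add: q_def z_def poly_sum sum_distrib_right mult.assoc)
      also have "\<dots> = (\<Sum>s\<in>I. \<Sum>d\<in>D. l s * c s d * h d t)"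
        using g(3) gt by (intro sum.cong) (auto simp: sum_distrib_left mult.assoc)
      also have "\<dots> = (\<Sum>d\<in>D. (\<Sum>s\<in>I. l s * c s d) * h d t)"
        by (subst sum.swap) (simp add: sum_distrib_right)
      also have "\<dots> = 0" using l(3) by simp
      finally show ?thesis using b by simp
    qed
    obtain a e where "a \<in> S" "\<exists>t. a t \<noteq> 0" "\<forall>t. a t \<noteq> 0 \<longrightarrow> \<beta> t \<noteq> 0 \<and> f t = e"
      using locally_constant_of_root[OF fb(1) \<beta>(1) q \<beta>(2)] supp by blast
    then show ?thesis using supp by blast
  qed
qed

end

section \<open>Principal ideals as algebras of functions\<close>

lemma function_algebra_of_subalgebra_of_C: "subalgebra_of_C K S \<Longrightarrow> function_algebra S"
  by unfold_locales (simp_all add: subalgebra_of_C_def)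

lemma subspace_principal_ideal: "subspace (principal_ideal w)"
proof (rule subspaceI)
  show "0 \<in> principal_ideal w" by (auto simp: principal_ideal_def intro: exI[of _ 0])
next
  fix x y assume "x \<in> principal_ideal w" "y \<in> principal_ideal w"
  then obtain c e where "\<bar>x\<bar> \<le> c *\<^sub>R \<bar>w\<bar>" "\<bar>y\<bar> \<le> e *\<^sub>R \<bar>w\<bar>" by (auto simp: principal_ideal_def)
  then have "\<bar>x\<bar> + \<bar>y\<bar> \<le> (c + e) *\<^sub>R \<bar>w\<bar>" by (simp add: add_mono scaleR_add_left)
  then show "x + y \<in> principal_ideal w"
    using abs_triangle_ineq[of x y] order_trans by (auto simp: principal_ideal_def)
next
  fix c x assume "x \<in> principal_ideal w"
  then obtain e where "\<bar>x\<bar> \<le> e *\<^sub>R \<bar>w\<bar>" by (auto simp: principal_ideal_def)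
  then have "\<bar>c\<bar> *\<^sub>R \<bar>x\<bar> \<le> (\<bar>c\<bar> * e) *\<^sub>R \<bar>w\<bar>"
    by (metis abs_ge_zero scaleR_left_mono scaleR_scaleR)
  then show "c *\<^sub>R x \<in> principal_ideal w"
    using abs_scaleR_le[of c x] order_trans by (auto simp: principal_ideal_def)
qed

lemma principal_ideal_solid:
  assumes "x \<in> principal_ideal w" "\<bar>y\<bar> \<le> \<bar>x\<bar>"
  shows "y \<in> principal_ideal w"
  using assms order_trans unfolding principal_ideal_def by blast

lemma principal_ideal_self: "w \<in> principal_ideal w"
  by (auto simp: principal_ideal_def intro: exI[of _ 1])

context
  fixes w :: "'a::archimedean_vector_lattice" and K :: "'k topology" and T
  assumes rep: "kakutani_krein_rep w K T"
begin

lemma rep_add: "u \<in> principal_ideal w \<Longrightarrow> v \<in> principal_ideal w \<Longrightarrow> T (u + v) = (\<lambda>t. T u t + T v t)"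
  using rep by (simp add: kakutani_krein_rep_def)

lemma rep_scaleR: "u \<in> principal_ideal w \<Longrightarrow> T (c *\<^sub>R u) = (\<lambda>t. c * T u t)"
  using rep by (simp add: kakutani_krein_rep_def)

lemma rep_eq_0_iff:
  assumes u: "u \<in> principal_ideal w"
  shows "(\<forall>t. T u t = 0) \<longleftrightarrow> u = 0"
proof -
  have "T 0 = (\<lambda>t. 0)" using rep_scaleR[OF u, of 0] by simp
  moreover have "inj_on T (principal_ideal w)" using rep by (simp add: kakutani_krein_rep_def)
  moreover have "0 \<in> principal_ideal w" by (rule subspace_0[OF subspace_principal_ideal])
  ultimately show ?thesis using u by (metis ext inj_onD)
qed

lemma rep_abs:
  assumes u: "u \<in> principal_ideal w"
  shows "T \<bar>u\<bar> t = \<bar>T u t\<bar>"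
proof -
  have mu: "- u \<in> principal_ideal w" using subspace_neg[OF subspace_principal_ideal u] .
  have "T (sup u (- u)) = sup (T u) (T (- u))"
    using rep u mu by (simp add: kakutani_krein_rep_def)
  then have "T \<bar>u\<bar> t = sup (T u t) (T (- u) t)" by (simp add: abs_lattice)
  also have "T (- u) t = - T u t" using rep_scaleR[OF u, of "-1"] by simp
  finally show ?thesis by (simp add: sup_max abs_real_def max_def)
qed

text \<open>
  This is the dictionary between the lattice and the algebra: two functions are disjoint exactly if
  their product vanishes.
\<close>

lemma rep_perp_iff:
  assumes u: "u \<in> principal_ideal w" and v: "v \<in> principal_ideal w"
  shows "u \<perp> v \<longleftrightarrow> (\<forall>t. T u t * T v t = 0)"
proof -
  have abs: "\<bar>u\<bar> \<in> principal_ideal w" "\<bar>v\<bar> \<in> principal_ideal w"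
    using u v by (auto intro: principal_ideal_solid)
  then have inf: "inf \<bar>u\<bar> \<bar>v\<bar> \<in> principal_ideal w"
    by (auto intro: principal_ideal_solid)
  have "T (inf \<bar>u\<bar> \<bar>v\<bar>) = inf (T \<bar>u\<bar>) (T \<bar>v\<bar>)"
    using rep abs by (simp add: kakutani_krein_rep_def)
  then have "T (inf \<bar>u\<bar> \<bar>v\<bar>) t = 0 \<longleftrightarrow> T u t * T v t = 0" for t
    using u v by (auto simp: rep_abs inf_min min_def)
  then show ?thesis using rep_eq_0_iff[OF inf] by (simp add: perp_def)
qed

lemma rep_sum:
  assumes "finite D" "D \<subseteq> principal_ideal w"
  shows "T (\<Sum>d\<in>D. c d *\<^sub>R d) t = (\<Sum>d\<in>D. c d * T d t)"
  using assms
proof (induction D rule: finite_induct)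
  case empty
  then show ?case
    using rep_eq_0_iff[OF subspace_0[OF subspace_principal_ideal]] by simp
next
  case (insert d D)
  have "(\<Sum>d\<in>D. c d *\<^sub>R d) \<in> principal_ideal w" "c d *\<^sub>R d \<in> principal_ideal w"
    using insert.prems by (auto intro!: subspace_sum subspace_scale subspace_principal_ideal)
  then show ?case using insert by (simp add: rep_add rep_scaleR)
qed

lemma rep_ccc:
  assumes csp: "countable_sup_property TYPE('a)"
    and A: "A \<subseteq> T ` principal_ideal w" "\<And>f. f \<in> A \<Longrightarrow> \<exists>t. f t \<noteq> 0"
      "pairwise (\<lambda>f g. \<forall>t. f t * g t = 0) A"
  shows "countable A"
proof -
  define A' where "A' = {u \<in> principal_ideal w. T u \<in> A}"
  have "0 \<notin> A'" using A(2) rep_eq_0_iff[of 0] by (force simp: A'_def)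
  moreover have "pairwise (\<perp>) A'"
  proof (rule pairwiseI)
    fix u v assume uv: "u \<in> A'" "v \<in> A'" "u \<noteq> v"
    have "inj_on T (principal_ideal w)" using rep by (simp add: kakutani_krein_rep_def)
    then have "T u \<noteq> T v" using uv by (auto simp: A'_def dest: inj_onD)
    then have "\<forall>t. T u t * T v t = 0" using A(3) uv by (simp add: A'_def pairwise_def)
    then show "u \<perp> v" using uv rep_perp_iff by (simp add: A'_def)
  qed
  ultimately have "countable A'" using csp unfolding countable_sup_property_def by blast
  moreover have "A = T ` A'" using A(1) by (auto simp: A'_def)
  ultimately show ?thesis by simp
qed

text \<open>
  The element \<open>b\<close> provided by maximality need not lie in the principal ideal, so it is replaced by
  \<open>inf \<bar>b\<bar> \<bar>x\<bar>\<close>, which does and is still not disjoint from \<open>x\<close>. Multiplying by \<open>x\<close> confines the support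
  to that of \<open>x\<close>.
\<close>

lemma rep_locally_spans:
  assumes D: "maximal_d_independent D" "finite D" "D \<subseteq> principal_ideal w"
    and alg: "function_algebra (T ` principal_ideal w)"
    and z: "z \<in> T ` principal_ideal w" "\<exists>t. z t \<noteq> 0"
  shows "\<exists>g\<in>T ` principal_ideal w. \<exists>c. (\<exists>t. g t \<noteq> 0) \<and>
      (\<forall>t. g t \<noteq> 0 \<longrightarrow> z t \<noteq> 0 \<and> z t = (\<Sum>d\<in>D. c d * T d t))"
proof -
  obtain x where x: "x \<in> principal_ideal w" "z = T x" using z by blast
  then have "x \<noteq> 0" using z(2) rep_eq_0_iff by blast
  then obtain b c where b: "\<not> b \<perp> x" "b \<perp> x - (\<Sum>d\<in>D. c d *\<^sub>R d)"
    using maximal_d_independent_locally_spans[OF D(1,2)] by blast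
  define y where "y = (\<Sum>d\<in>D. c d *\<^sub>R d)"
  define b' where "b' = inf \<bar>b\<bar> \<bar>x\<bar>"
  have b'b: "\<bar>b'\<bar> \<le> \<bar>b\<bar>" and b'x: "\<bar>b'\<bar> \<le> \<bar>x\<bar>" and "b' \<noteq> 0"
    using b(1) by (auto simp: b'_def perp_def)
  have b': "b' \<in> principal_ideal w" by (rule principal_ideal_solid[OF x(1) b'x])
  have y: "y \<in> principal_ideal w" unfolding y_def
    using D by (intro subspace_sum subspace_scale subspace_principal_ideal) auto
  have xy: "x - y \<in> principal_ideal w"
    using subspace_diff[OF subspace_principal_ideal x(1) y] .
  have "\<not> b' \<perp> x"
    using \<open>b' \<noteq> 0\<close> perp_mono[of b' x b'] b'x perp_self_iff by blast
  then obtain t where t: "T b' t * T x t \<noteq> 0" using rep_perp_iff[OF b' x(1)] by blast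
  have "x - y \<perp> b" using b(2) unfolding y_def by (subst perp_commute)
  then have "x - y \<perp> b'" using b'b by (rule perp_mono)
  then have zero: "T (x - y) t * T b' t = 0" for t using rep_perp_iff[OF xy b'] by blast
  have "T x t = (\<Sum>d\<in>D. c d * T d t)" if "T b' t \<noteq> 0" for t
  proof -
    have "T x t = T (x - y) t + T y t" using rep_add[OF xy y] by (simp add: fun_eq_iff)
    then show ?thesis using zero[of t] that rep_sum[OF D(2,3)] by (simp add: y_def)
  qed
  then show ?thesis
    using t function_algebra.mult[OF alg imageI[OF b'] imageI[OF x(1)]] x(2)
    by (intro bexI[of _ "\<lambda>t. T b' t * T x t"]) auto
qed

end

text \<open>
  Local constancy is used twice, first for \<open>x\<close> and then for \<open>u\<close> on the piece already found. The
  value of \<open>u\<close> there is not zero: \<open>u\<close> dominates every \<open>\<bar>d\<bar>\<close>, so otherwise all combinations of \<open>D\<close>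
  would vanish on the piece, although one of them agrees with the non-zero function \<open>a'\<close> on a part of it.
\<close>

lemma locally_multiple_of_sum:
  fixes D :: "'a::archimedean_vector_lattice set"
  defines "u \<equiv> \<Sum>d\<in>D. \<bar>d\<bar>"
  assumes local_alg: "local_algebra TYPE('a)" and csp: "countable_sup_property TYPE('a)"
    and D: "maximal_d_independent D" "finite D" and x0: "x \<noteq> 0"
  shows "u \<noteq> 0 \<and> (\<exists>b c. \<not> b \<perp> x \<and> c \<noteq> 0 \<and> b \<perp> x + c *\<^sub>R u)"
proof -
  have du: "\<bar>d\<bar> \<le> u" if "d \<in> D" for d
  proof -
    have "u = \<bar>d\<bar> + (\<Sum>d\<in>D - {d}. \<bar>d\<bar>)"
      unfolding u_def using D(2) that by (rule sum.remove)
    moreover have "0 \<le> (\<Sum>d\<in>D - {d}. \<bar>d\<bar>)" by (intro sum_nonneg) auto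
    ultimately show ?thesis by simp
  qed
  have u0: "0 \<le> u" unfolding u_def by (intro sum_nonneg) auto
  \<comment> \<open>An element whose principal ideal contains all elements under consideration.\<close>
  define w where "w = \<bar>x\<bar> + u"
  have w0: "0 \<le> w" using u0 by (simp add: w_def)
  have I: "y \<in> principal_ideal w" if "\<bar>y\<bar> \<le> w" for y
    using that w0 by (intro principal_ideal_solid[OF principal_ideal_self]) simp
  have xI: "x \<in> principal_ideal w"
    by (rule I) (use u0 in \<open>simp add: w_def\<close>)
  have uw: "u \<le> w" by (simp add: w_def)
  then have uI: "u \<in> principal_ideal w"
    using u0 by (intro I) simp
  have DI: "D \<subseteq> principal_ideal w"
    using order_trans[OF du uw] I by blast
  obtain K :: "('a \<Rightarrow> real) topology" and T where
    rep: "kakutani_krein_rep w K T" and sub: "subalgebra_of_C K (T ` principal_ideal w)"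
    using local_alg unfolding local_algebra_def by blast
  let ?S = "T ` principal_ideal w"
  interpret function_algebra ?S
    using sub by (rule function_algebra_of_subalgebra_of_C)
  note span = rep_locally_spans[OF rep D DI function_algebra_axioms]
  have const: "\<exists>a\<in>?S. \<exists>c. (\<exists>t. a t \<noteq> 0) \<and> (\<forall>t. a t \<noteq> 0 \<longrightarrow> b t \<noteq> 0 \<and> f t = c)"
    if "f \<in> ?S" "b \<in> ?S" "b t0 \<noteq> 0" for f b t0
  proof (rule locally_constant[OF _ D(2) _ that])
    show "countable A" if "A \<subseteq> ?S" "\<And>f. f \<in> A \<Longrightarrow> \<exists>t. f t \<noteq> 0"
      "pairwise (\<lambda>f g. \<forall>t. f t * g t = 0) A" for A
      using rep_ccc[OF rep csp that] .
    show "\<exists>g\<in>?S. \<exists>c. (\<exists>t. g t \<noteq> 0) \<and>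
        (\<forall>t. g t \<noteq> 0 \<longrightarrow> z t \<noteq> 0 \<and> z t = (\<Sum>d\<in>D. c d * T d t))"
      if "z \<in> ?S" "\<exists>t. z t \<noteq> 0" for z
      using span[OF that] .
  qed
  obtain t0 where t0: "T x t0 \<noteq> 0" using rep_eq_0_iff[OF rep xI] x0 by blast
  obtain a c t1 where a: "a \<in> ?S" "a t1 \<noteq> 0" "\<And>t. a t \<noteq> 0 \<Longrightarrow> T x t \<noteq> 0 \<and> T x t = c"
    using const[OF imageI[OF xI] imageI[OF xI] t0] by blast
  obtain a' e t2 where a': "a' \<in> ?S" "a' t2 \<noteq> 0" "\<And>t. a' t \<noteq> 0 \<Longrightarrow> a t \<noteq> 0 \<and> T u t = e"
    using const[OF imageI[OF uI] a(1,2)] by blast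
  have c: "c \<noteq> 0" using a(2,3) by force
  have e: "e \<noteq> 0"
  proof
    assume "e = 0"
    have "\<exists>t. a' t \<noteq> 0" using a'(2) by blast
    from span[OF a'(1) this] obtain l t where g: "a' t \<noteq> 0" "a' t = (\<Sum>d\<in>D. l d * T d t)"
      by blast
    then have Tu: "T u t = 0" using a'(3) \<open>e = 0\<close> by blast
    have "T d t = 0" if d: "d \<in> D" for d
    proof -
      have dI: "d \<in> principal_ideal w" using DI d by blast
      have dabs: "\<bar>d\<bar> \<in> principal_ideal w" using principal_ideal_solid[OF dI] by simp
      have "inf \<bar>d\<bar> u = \<bar>d\<bar>" using du[OF d] by (simp add: inf_absorb1)
      moreover have "T (inf \<bar>d\<bar> u) = inf (T \<bar>d\<bar>) (T u)"
        using rep dabs uI by (simp add: kakutani_krein_rep_def)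
      ultimately have "T \<bar>d\<bar> t \<le> T u t" by (metis inf_apply inf_le2)
      then show ?thesis using Tu rep_abs[OF rep dI] by simp
    qed
    then show False using g by simp
  qed
  obtain b where b: "b \<in> principal_ideal w" "a' = T b" using a'(1) by blast
  have "u \<noteq> 0" using a'(2,3) e rep_eq_0_iff[OF rep uI] by blast
  moreover have "\<not> b \<perp> x"
    using rep_perp_iff[OF rep b(1) xI] a(3) a'(2,3) b(2) by (metis mult_eq_0_iff)
  moreover have "b \<perp> x + (- c / e) *\<^sub>R u"
  proof -
    have cu: "(- c / e) *\<^sub>R u \<in> principal_ideal w"
      by (rule subspace_scale[OF subspace_principal_ideal uI])
    have "T (x + (- c / e) *\<^sub>R u) t = T x t + (- c / e) * T u t" for t
      by (simp only: rep_add[OF rep xI cu] rep_scaleR[OF rep uI])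
    then have "T b t * T (x + (- c / e) *\<^sub>R u) t = 0" for t
      using a(3)[of t] a'(3)[of t] e b(2) by (cases "a' t = 0") auto
    then show ?thesis
      using rep_perp_iff[OF rep b(1) subspace_add[OF subspace_principal_ideal xI cu]] by blast
  qed
  ultimately show ?thesis using c e by (metis divide_eq_0_iff neg_equal_0_iff_equal)
qed

theorem theorem4p15:
  assumes nonzero: "\<exists>x::'a::archimedean_vector_lattice. x \<noteq> 0"
    and local_alg: "local_algebra TYPE('a)"
    and no_singleton: "\<not> (\<exists>x::'a. maximal_d_independent {x})"
    and csp: "countable_sup_property TYPE('a)"
  shows "\<forall>D :: 'a set. maximal_d_independent D \<longrightarrow> infinite D"
proof (intro allI impI notI)
  fix D :: "'a set"
  assume D: "maximal_d_independent D" "finite D"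
  define u where "u = (\<Sum>d\<in>D. \<bar>d\<bar>)"
  note key = locally_multiple_of_sum[OF local_alg csp D, folded u_def]
  have "u \<noteq> 0" using key nonzero by blast
  then have "d_independent {u}" by (rule d_independent_singleton)
  \<comment> \<open>A further element \<open>x\<close> cannot be adjoined to \<open>u\<close>, as \<open>x + c u\<close> vanishes on some part of the support of \<open>x\<close>.\<close>
  moreover have "D' = {u}" if D': "d_independent D'" "{u} \<subseteq> D'" for D'
  proof (rule ccontr)
    assume "D' \<noteq> {u}"
    then obtain x where x: "x \<in> D'" "x \<noteq> u" using D'(2) by blast
    then have "x \<noteq> 0" using D'(1) by (auto simp: d_independent_iff)
    then obtain b c where b: "\<not> b \<perp> x" "c \<noteq> 0" "b \<perp> x + c *\<^sub>R u" using key by blast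
    let ?c = "\<lambda>y. if y = x then 1 else c"
    have "(\<Sum>y\<in>{x, u}. ?c y *\<^sub>R y) = x + c *\<^sub>R u" using x(2) by simp
    then have "b \<perp> (\<Sum>y\<in>{x, u}. ?c y *\<^sub>R y)" using b(3) by simp
    moreover have "finite {x, u}" "{x, u} \<subseteq> D'" "\<forall>y\<in>{x, u}. ?c y \<noteq> 0"
      using x D'(2) b(2) by auto
    ultimately have "b \<perp> x"
      using d_independentD[OF D'(1), of "{x, u}" ?c b x] by blast
    then show False using b(1) by simp
  qed
  ultimately show False using no_singleton unfolding maximal_d_independent_def by blast
qed

end
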